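(* Let $\mu$ be the product measure of $n$ symmetric Bernoulli distributions $\mu_i = \frac12\delta_{+1}+\frac12\delta_{-1}$ on $\{\pm1\}$, and define $f \colon \mathbb{R}^n \to \mathbb{R}$ by $$f(x_1,\ldots,x_n) := \sum_{i<j}\alpha_{ij}x_ix_j + \sum_{i<j<k}\alpha_{ijk}x_ix_jx_k + \ldots,$$ where the sum goes up to order $n$ and the $\alpha_{i_1\ldots i_d}$ ($2\le d\le n$, $i_1<\ldots<i_d$) are any real numbers. Set $B := \sup_{x\in\{\pm1\}^n}\lVert \mathfrak{D}^{(2)}f(x)\rVert_{\mathrm{HS}}$. Then $$\int \exp\left(\frac{1}{5B}|f|\right) d\mu \le 2.$$
   Context: For $f$ and $i=1,\ldots,n$, let $\mathfrak{D}_if(x):=f(x)-\int f(x_1,\ldots,x_{i-1},y_i,x_{i+1},\ldots,x_n)\mu_i(dy_i)$; for the symmetric Bernoulli measures and $x\in\{\pm1\}^n$ this is $\mathfrak{D}_if(x)=\frac12\big(f(x)-f(x_1,\ldots,-x_i,\ldots,x_n)\big)$. Set $\mathfrak{D}_{ij}f:=\mathfrak{D}_i(\mathfrak{D}_jf)$, and let $\mathfrak{D}^{(2)}f(x)$ be the $n\times n$ matrix with entries $\mathfrak{D}_{ij}f(x)$ for $i\ne j$ and $0$ on the diagonal. $\lVert A\rVert_{\mathrm{HS}}=(\sum_{i,j}|a_{ij}|^2)^{1/2}$. *)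

theory Defs
  imports "HOL-Probability.Probability"
begin

text \<open>Points of \<open>\<real>\<^sup>n\<close> are functions \<^typ>\<open>nat \<Rightarrow> real\<close> of which only the coordinates in \<open>{1..n}\<close> matter.
  The cube is the underlying space of the product measure below, so its elements are
  \<^const>\<open>undefined\<close> outside \<open>{1..n}\<close>.\<close>

definition cube :: "nat \<Rightarrow> (nat \<Rightarrow> real) set" where
  "cube n = {1..n} \<rightarrow>\<^sub>E {-1, 1}"

text \<open>Half the Dirac mass at 1 plus half the Dirac mass at -1, on the discrete space \<open>{-1, 1}\<close>.\<close>

definition symm_bernoulli :: "real measure" where
  "symm_bernoulli = point_measure {-1, 1} (\<lambda>_. 1/2)"

definition cube_measure :: "nat \<Rightarrow> (nat \<Rightarrow> real) measure" where
  "cube_measure n = PiM {1..n} (\<lambda>_. symm_bernoulli)"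

definition diff_op ::
  "(nat \<Rightarrow> real measure) \<Rightarrow> nat \<Rightarrow> ((nat \<Rightarrow> real) \<Rightarrow> real) \<Rightarrow> (nat \<Rightarrow> real) \<Rightarrow> real" where
  "diff_op \<mu> i f x = f x - (\<integral>y. f (x(i := y)) \<partial>\<mu> i)"

definition diff2_matrix ::
  "(nat \<Rightarrow> real measure) \<Rightarrow> ((nat \<Rightarrow> real) \<Rightarrow> real) \<Rightarrow> (nat \<Rightarrow> real) \<Rightarrow> nat \<Rightarrow> nat \<Rightarrow> real" where
  "diff2_matrix \<mu> f x i j = (if i = j then 0 else diff_op \<mu> i (diff_op \<mu> j f) x)"

definition HS_norm :: "nat \<Rightarrow> (nat \<Rightarrow> nat \<Rightarrow> real) \<Rightarrow> real" where
  "HS_norm n A = sqrt (\<Sum>i=1..n. \<Sum>j=1..n. \<bar>A i j\<bar>\<^sup>2)"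

text \<open>An increasing index tuple \<open>i\<^sub>1 < \<dots> < i\<^sub>d\<close> is encoded by the set of its entries.\<close>

definition tetrahedral_poly :: "nat \<Rightarrow> (nat set \<Rightarrow> real) \<Rightarrow> (nat \<Rightarrow> real) \<Rightarrow> real" where
  "tetrahedral_poly n \<alpha> x = (\<Sum>d=2..n. \<Sum>I | I \<subseteq> {1..n} \<and> card I = d. \<alpha> I * (\<Prod>i\<in>I. x i))"

lemma integral_symm_bernoulli:
  "(\<integral>y. g y \<partial>symm_bernoulli) = (g 1 + g (-1)) / 2" for g :: "real \<Rightarrow> real"
proof -
  have "(1/2 :: ennreal) = ennreal (1/2)"
    using divide_ennreal[of 1 2] by simp
  then have "symm_bernoulli = point_measure {-1, 1} (\<lambda>_. ennreal (1/2))"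
    by (simp only: symm_bernoulli_def)
  then have "(\<integral>y. g y \<partial>symm_bernoulli) = (\<Sum>a\<in>{-1, 1}. (1/2) *\<^sub>R g a)"
    using lebesgue_integral_point_measure_finite[of "{-1, 1 :: real}" "\<lambda>_. 1/2" g] by simp
  then show ?thesis by (simp add: field_simps)
qed

lemma diff_op_symm_bernoulli:
  assumes "x i \<in> {-1, 1}"
  shows "diff_op (\<lambda>_. symm_bernoulli) i f x = (f x - f (x(i := - x i))) / 2"
proof -
  consider "x i = 1" "x(i := 1) = x" | "x i = -1" "x(i := -1) = x"
    using assms by (metis fun_upd_triv insertE singletonD)
  then show ?thesis
    by cases (simp_all add: diff_op_def integral_symm_bernoulli field_simps)
qed

lemma prob_space_symm_bernoulli: "prob_space symm_bernoulli"
proof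
  have "2 * inverse (2 :: ennreal) = 1"
    using ennreal_divide_self[of 2] by (simp add: divide_ennreal_def)
  then show "emeasure symm_bernoulli (space symm_bernoulli) = 1"
    unfolding symm_bernoulli_def
    by (simp add: space_point_measure emeasure_point_measure_finite divide_ennreal_def)
qed

lemma space_cube_measure: "space (cube_measure n) = cube n"
  by (simp add: cube_measure_def cube_def space_PiM symm_bernoulli_def space_point_measure)

lemma sets_cube_measure: "sets (cube_measure n) = Pow (cube n)"
proof -
  have "sets (cube_measure n) = sets (PiM {1..n} (\<lambda>_. count_space {-1, 1 :: real}))"
    unfolding cube_measure_def
    by (intro sets_PiM_cong) (auto simp: symm_bernoulli_def sets_point_measure)
  also have "\<dots> = sets (count_space (cube n))"
    unfolding cube_def by (subst count_space_PiM_finite) auto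
  finally show ?thesis by simp
qed

text \<open>Hence no Bochner integral over the cube takes its default value 0.\<close>

lemma integrable_cube_measure: "integrable (cube_measure n) g" for g :: "(nat \<Rightarrow> real) \<Rightarrow> real"
proof -
  interpret prob_space "cube_measure n"
    unfolding cube_measure_def by (rule prob_space_PiM) (rule prob_space_symm_bernoulli)
  have fin: "finite (cube n)"
    unfolding cube_def by (intro finite_PiE) auto
  have "g \<in> borel_measurable (cube_measure n)"
    by (auto simp: measurable_def sets_cube_measure space_cube_measure)
  moreover have "\<And>x. x \<in> cube n \<Longrightarrow> norm (g x) \<le> (\<Sum>y\<in>cube n. norm (g y))"
    by (rule member_le_sum) (use fin in auto)
  ultimately show ?thesis
    by (intro integrable_const_bound[where B = "\<Sum>y\<in>cube n. norm (g y)"] AE_I2)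
      (auto simp: space_cube_measure)
qed

end

theory Submission
  imports Defs
begin

text \<open>
  The proof bounds all even moments of \<open>f\<close> by \<open>E f\<^bsup>p\<^esup> \<le> ((p - 1) B)\<^bsup>p\<^esup>\<close> and sums the exponential
  series. Write \<open>D\<^sub>i g(x) = (g(x) - g(\<sigma>\<^sub>i x)) / 2\<close>, where \<open>\<sigma>\<^sub>i\<close> flips the \<open>i\<close>-th sign.

  The engine is a Poincare-type inequality for moments (\<open>moment_poincare\<close>): for a vector-valued
  \<open>F\<close> of mean zero on the cube and even \<open>p\<close>,
  \<open>E |F|\<^bsup>p\<^esup> \<le> (p - 1)\<^bsup>p/2\<^esup> E (\<Sum>\<^sub>i |D\<^sub>i F|\<^sup>2)\<^bsup>p/2\<^esup>\<close>. The number operator \<open>N = \<Sum>\<^sub>i D\<^sub>i\<close> multiplies the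
  Walsh monomial of a set \<open>S\<close> by \<open>|S|\<close>, so that \<open>F = N G\<close> for some \<open>G\<close>, and as every \<open>D\<^sub>i\<close> is an orthogonal
  projection, \<open>E |F|\<^bsup>p\<^esup> = \<Sum>\<^sub>i E \<langle>D\<^sub>i(|F|\<^bsup>p-2\<^esup> F), D\<^sub>i G\<rangle>\<close>. The map \<open>a \<mapsto> |a|\<^bsup>p-2\<^esup> a\<close> has Lipschitz quotients of
  size \<open>(p - 1) |a|\<^bsup>p-2\<^esup>\<close> (\<open>power_vector_diff_inner_le\<close>), which bounds the right side by
  \<open>(p - 1) E |F|\<^bsup>p-2\<^esup> |DF| |DG|\<close>. Finally \<open>x\<^sub>i D\<^sub>i G\<close> solves the resolvent equation \<open>u + N u = x\<^sub>i D\<^sub>i F\<close>, and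
  the resolvent contracts \<open>L\<^sup>p\<close> (\<open>resolvent_contraction\<close>); hence \<open>DG\<close> may be replaced by \<open>DF\<close>, and Young's
  inequality absorbs \<open>|F|\<^bsup>p-2\<^esup>\<close>.

  This inequality is used twice, first for \<open>f\<close> and then for the vector of partial derivatives
  \<open>\<partial>\<^sub>i f = x\<^sub>i D\<^sub>i f\<close>. Both steps require mean zero, and this is where the absence of monomials
  of degree below two enters. Since \<open>\<partial>\<^sub>i f\<close> does not depend on \<open>x\<^sub>i\<close>, its \<open>i\<close>-th difference is zero, while for
  \<open>j \<noteq> i\<close> its \<open>j\<close>-th difference is \<open>D\<^sub>j\<^sub>i f\<close> up to sign. So the second step ends exactly at the
  Hilbert-Schmidt norm of the matrix of second differences, which has a zero diagonal.
\<close>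

section \<open>Inequalities for finite sums and powers\<close>

lemma power_diff_sign:
  fixes A B :: real
  assumes "A \<ge> 0" "B \<ge> 0"
  shows "0 \<le> (A ^ r - B ^ r) * (A - B)"
proof (cases "A \<le> B")
  case True
  then show ?thesis
    using power_mono[of A B r] assms by (intro mult_nonpos_nonpos) auto
next
  case False
  then show ?thesis
    using power_mono[of B A r] assms by (intro mult_nonneg_nonneg) auto
qed

lemma mult_le_half_squares: "a * b \<le> (a\<^sup>2 + b\<^sup>2) / 2" for a b :: real
  using sum_squares_bound[of a b] by simp

text \<open>The mean value theorem in the form needed for squared lengths \<open>A\<close>, \<open>B\<close>: the quotient
  \<open>(A\<^bsup>r\<^esup> - B\<^bsup>r\<^esup>) / (A - B)\<close> is compared with \<open>r\<close> times the ratio of the averages of \<open>A\<^bsup>r\<^esup>\<close>, \<open>B\<^bsup>r\<^esup>\<close>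
  and of \<open>A\<close>, \<open>B\<close>, so that only the power \<open>r\<close> occurs. The step of the induction is Chebyshev's sum inequality.\<close>

lemma power_diff_times_sum_le:
  fixes A B :: real
  assumes "A \<ge> 0" "B \<ge> 0"
  shows "\<bar>A ^ r - B ^ r\<bar> * (A + B) \<le> r * \<bar>A - B\<bar> * (A ^ r + B ^ r)"
proof (induction r)
  case 0
  then show ?case by simp
next
  case (Suc r)
  have cheb: "(A + B) * (A ^ r + B ^ r) \<le> 2 * (A ^ Suc r + B ^ Suc r)"
    using power_diff_sign[OF assms, of r] by (simp add: algebra_simps)
  have "A ^ Suc r - B ^ Suc r = ((A ^ r - B ^ r) * (A + B) + (A ^ r + B ^ r) * (A - B)) / 2"
    by (simp add: field_simps)
  then have "\<bar>A ^ Suc r - B ^ Suc r\<bar>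
      = \<bar>(A ^ r - B ^ r) * (A + B) + (A ^ r + B ^ r) * (A - B)\<bar> / 2"
    by (simp only: abs_divide abs_numeral)
  also have "\<dots> \<le> (\<bar>(A ^ r - B ^ r) * (A + B)\<bar> + \<bar>(A ^ r + B ^ r) * (A - B)\<bar>) / 2"
    by (intro divide_right_mono abs_triangle_ineq) simp
  also have "\<dots> = (\<bar>A ^ r - B ^ r\<bar> * (A + B) + (A ^ r + B ^ r) * \<bar>A - B\<bar>) / 2"
    using assms by (simp add: abs_mult)
  also have "\<dots> \<le> (r * \<bar>A - B\<bar> * (A ^ r + B ^ r) + (A ^ r + B ^ r) * \<bar>A - B\<bar>) / 2"
    using Suc by simp
  also have "\<dots> = (Suc r * \<bar>A - B\<bar> / 2) * (A ^ r + B ^ r)"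
    by (simp add: field_simps)
  finally have "\<bar>A ^ Suc r - B ^ Suc r\<bar> * (A + B)
      \<le> (Suc r * \<bar>A - B\<bar> / 2) * (A ^ r + B ^ r) * (A + B)"
    using assms by (intro mult_right_mono) auto
  also have "\<dots> = (Suc r * \<bar>A - B\<bar> / 2) * ((A + B) * (A ^ r + B ^ r))"
    by simp
  also have "\<dots> \<le> (Suc r * \<bar>A - B\<bar> / 2) * (2 * (A ^ Suc r + B ^ Suc r))"
    by (intro mult_left_mono cheb) simp
  finally show ?case by (simp del: distrib_left_numeral power_Suc of_nat_Suc)
qed

text \<open>For vectors with \<open>A = |a|\<^sup>2\<close> and \<open>B = |b|\<^sup>2\<close>, the vector \<open>A\<^bsup>r\<^esup> a - B\<^bsup>r\<^esup> b\<close> has length at most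
  \<open>(2 r + 1) |a - b|\<close> times the average of \<open>A\<^bsup>r\<^esup>\<close> and \<open>B\<^bsup>r\<^esup>\<close>, because the derivative of \<open>a \<mapsto> |a|\<^bsup>2r\<^esup> a\<close>
  has norm \<open>(2 r + 1) |a|\<^bsup>2r\<^esup>\<close>, a convex function along the segment. The factor \<open>2 r + 1\<close> is sharp.\<close>

lemma power_vector_diff_inner_le:
  fixes a b w :: "'k \<Rightarrow> real" and K :: "'k set"
  defines "A \<equiv> \<Sum>k\<in>K. (a k)\<^sup>2" and "B \<equiv> \<Sum>k\<in>K. (b k)\<^sup>2"
  shows "(\<Sum>k\<in>K. (A ^ r * a k - B ^ r * b k) * w k)
    \<le> real (2 * r + 1) / 4 * (A ^ r + B ^ r) * ((\<Sum>k\<in>K. (a k - b k)\<^sup>2) + (\<Sum>k\<in>K. (w k)\<^sup>2))"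
proof -
  define d s where "d k = a k - b k" and "s k = a k + b k" for k
  define D W S where "D = (\<Sum>k\<in>K. (d k)\<^sup>2)" and "W = (\<Sum>k\<in>K. (w k)\<^sup>2)" and "S = (\<Sum>k\<in>K. (s k)\<^sup>2)"
  define dw sw ds where "dw = (\<Sum>k\<in>K. d k * w k)" and "sw = (\<Sum>k\<in>K. s k * w k)"
    and "ds = (\<Sum>k\<in>K. d k * s k)"
  have nonneg: "A \<ge> 0" "B \<ge> 0" "D \<ge> 0" "W \<ge> 0" "S \<ge> 0"
    by (simp_all add: A_def B_def D_def W_def S_def sum_nonneg)
  \<comment> \<open>Leibniz rule: one part differences the vector, the other one its length.\<close>
  have split: "(\<Sum>k\<in>K. (A ^ r * a k - B ^ r * b k) * w k)
      = (A ^ r + B ^ r) / 2 * dw + (A ^ r - B ^ r) / 2 * sw"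
    unfolding dw_def sw_def sum_distrib_left sum.distrib[symmetric]
    by (intro sum.cong refl) (simp add: d_def s_def field_simps)
  have "dw \<le> (\<Sum>k\<in>K. ((d k)\<^sup>2 + (w k)\<^sup>2) / 2)"
    unfolding dw_def by (intro sum_mono mult_le_half_squares)
  also have "\<dots> = (D + W) / 2"
    by (simp add: D_def W_def sum.distrib sum_divide_distrib[symmetric])
  finally have dw: "dw \<le> (D + W) / 2" .
  \<comment> \<open>As \<open>A - B\<close> is itself an inner product with \<open>a + b\<close>, two uses of Cauchy-Schwarz suffice for the second part.\<close>
  have AB: "A - B = ds"
    unfolding A_def B_def ds_def sum_subtractf[symmetric]
    by (intro sum.cong refl) (simp add: d_def s_def power2_eq_square algebra_simps)
  have "S \<le> (\<Sum>k\<in>K. 2 * ((a k)\<^sup>2 + (b k)\<^sup>2))"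
    unfolding S_def
  proof (intro sum_mono)
    fix k show "(s k)\<^sup>2 \<le> 2 * ((a k)\<^sup>2 + (b k)\<^sup>2)"
      using zero_le_power2[of "a k - b k"] by (simp add: s_def power2_sum power2_diff)
  qed
  also have "\<dots> = 2 * (A + B)"
    by (simp add: A_def B_def sum.distrib sum_distrib_left[symmetric])
  finally have S: "S \<le> 2 * (A + B)" .
  have sw: "\<bar>A ^ r - B ^ r\<bar> * \<bar>sw\<bar> \<le> r * (A ^ r + B ^ r) * (D + W)"
  proof (cases "A + B = 0")
    case True
    then have "A = B" using nonneg by linarith
    then show ?thesis using nonneg by simp
  next
    case False
    then have pos: "A + B > 0" using nonneg by linarith
    have "ds\<^sup>2 \<le> D * S" "sw\<^sup>2 \<le> S * W"
      unfolding ds_def sw_def D_def S_def W_def by (rule Cauchy_Schwarz_ineq_sum)+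
    moreover have "2 * (\<bar>ds\<bar> * \<bar>sw\<bar>) \<le> ds\<^sup>2 + sw\<^sup>2"
      using sum_squares_bound[of "\<bar>ds\<bar>" "\<bar>sw\<bar>"] by simp
    ultimately have "2 * (\<bar>ds\<bar> * \<bar>sw\<bar>) \<le> S * (D + W)"
      by (simp add: algebra_simps)
    also have "\<dots> \<le> 2 * (A + B) * (D + W)"
      using S nonneg by (intro mult_right_mono) auto
    finally have dssw: "\<bar>ds\<bar> * \<bar>sw\<bar> \<le> (A + B) * (D + W)" by (simp add: mult.assoc del: distrib_left_numeral)
    have "\<bar>A ^ r - B ^ r\<bar> * \<bar>sw\<bar> * (A + B) = (\<bar>A ^ r - B ^ r\<bar> * (A + B)) * \<bar>sw\<bar>"
      by simp
    also have "\<dots> \<le> (r * \<bar>ds\<bar> * (A ^ r + B ^ r)) * \<bar>sw\<bar>"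
      using power_diff_times_sum_le[of A B r] nonneg
      by (intro mult_right_mono) (auto simp: AB)
    also have "\<dots> = (r * (A ^ r + B ^ r)) * (\<bar>ds\<bar> * \<bar>sw\<bar>)"
      by simp
    also have "\<dots> \<le> (r * (A ^ r + B ^ r)) * ((A + B) * (D + W))"
      using dssw nonneg by (intro mult_left_mono) auto
    also have "\<dots> = r * (A ^ r + B ^ r) * (D + W) * (A + B)"
      by simp
    finally show ?thesis using pos by simp
  qed
  have "(A ^ r + B ^ r) / 2 * dw \<le> (A ^ r + B ^ r) / 2 * ((D + W) / 2)"
    using dw nonneg by (intro mult_left_mono) auto
  moreover have "(A ^ r - B ^ r) / 2 * sw \<le> r * (A ^ r + B ^ r) * (D + W) / 2"
  proof -
    have "(A ^ r - B ^ r) * sw \<le> \<bar>A ^ r - B ^ r\<bar> * \<bar>sw\<bar>"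
      by (metis abs_ge_self abs_mult)
    with sw show ?thesis by simp
  qed
  ultimately have "(\<Sum>k\<in>K. (A ^ r * a k - B ^ r * b k) * w k)
      \<le> (A ^ r + B ^ r) / 2 * ((D + W) / 2) + r * (A ^ r + B ^ r) * (D + W) / 2"
    unfolding split by linarith
  also have "\<dots> = real (2 * r + 1) / 4 * (A ^ r + B ^ r) * (D + W)"
  proof -
    have "p / 2 * (q / 2) + r * p * q / 2 = real (2 * r + 1) / 4 * p * q" for p q :: real
      by (simp add: field_simps)
    then show ?thesis .
  qed
  finally show ?thesis by (simp add: D_def W_def d_def add.commute)
qed

text \<open>Monotonicity of the gradient \<open>a \<mapsto> |a|\<^bsup>2r\<^esup> a\<close> of a convex function.\<close>

lemma power_vector_diff_inner_nonneg:
  fixes a b :: "'k \<Rightarrow> real" and K :: "'k set"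
  defines "A \<equiv> \<Sum>k\<in>K. (a k)\<^sup>2" and "B \<equiv> \<Sum>k\<in>K. (b k)\<^sup>2"
  shows "0 \<le> (\<Sum>k\<in>K. (A ^ r * a k - B ^ r * b k) * (a k - b k))"
proof -
  define ab where "ab = (\<Sum>k\<in>K. a k * b k)"
  have nonneg: "A \<ge> 0" "B \<ge> 0"
    by (simp_all add: A_def B_def sum_nonneg)
  have "(\<Sum>k\<in>K. (A ^ r * a k - B ^ r * b k) * (a k - b k))
     = (\<Sum>k\<in>K. A ^ r * (a k)\<^sup>2 + B ^ r * (b k)\<^sup>2 - (A ^ r + B ^ r) * (a k * b k))"
    by (intro sum.cong refl) (simp add: power2_eq_square algebra_simps)
  also have "\<dots> = A ^ r * A + B ^ r * B - (A ^ r + B ^ r) * ab"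
    by (simp add: A_def B_def ab_def sum.distrib sum_subtractf sum_distrib_left)
  finally have eq: "(\<Sum>k\<in>K. (A ^ r * a k - B ^ r * b k) * (a k - b k))
     = A ^ r * A + B ^ r * B - (A ^ r + B ^ r) * ab" .
  have "ab \<le> (\<Sum>k\<in>K. ((a k)\<^sup>2 + (b k)\<^sup>2) / 2)"
    unfolding ab_def by (intro sum_mono mult_le_half_squares)
  also have "\<dots> = (A + B) / 2"
    by (simp add: A_def B_def sum.distrib sum_divide_distrib[symmetric])
  finally have "(A ^ r + B ^ r) * ab \<le> (A ^ r + B ^ r) * ((A + B) / 2)"
    using nonneg by (intro mult_left_mono) auto
  moreover have "0 \<le> (A ^ r - B ^ r) * (A - B)"
    using nonneg by (rule power_diff_sign)
  ultimately show ?thesis unfolding eq by (simp add: algebra_simps)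
qed

text \<open>Young's inequality with exponents \<open>(r + 1) / r\<close> and \<open>r + 1\<close>; the integer form has an inductive proof.\<close>

lemma power_times_le_convex:
  fixes X Y :: real
  assumes "X \<ge> 0" "Y \<ge> 0"
  shows "Suc r * (X ^ r * Y) \<le> r * X ^ Suc r + Y ^ Suc r"
proof (induction r)
  case 0
  then show ?case by simp
next
  case (Suc r)
  have cheb: "0 \<le> (X ^ Suc r - Y ^ Suc r) * (X - Y)"
    using assms by (rule power_diff_sign)
  have "X * (Suc r * (X ^ r * Y)) \<le> X * (r * X ^ Suc r + Y ^ Suc r)"
    by (intro mult_left_mono Suc assms)
  with cheb show ?case by (simp add: algebra_simps)
qed

text \<open>A bound of the \<open>(r + 1)\<close>-st moment of \<open>X\<close> by itself, tested against \<open>Y\<close> and \<open>Z\<close>, turns into a bound by the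
  moments of \<open>Y\<close> and \<open>Z\<close>: Young's inequality returns the fraction \<open>r / (r + 1)\<close> of the left side.\<close>

lemma sum_power_absorb:
  fixes X Y Z :: "'a \<Rightarrow> real"
  assumes nonneg: "\<And>x. x \<in> C \<Longrightarrow> X x \<ge> 0" "\<And>x. x \<in> C \<Longrightarrow> Y x \<ge> 0" "\<And>x. x \<in> C \<Longrightarrow> Z x \<ge> 0"
    and le: "(\<Sum>x\<in>C. X x ^ Suc r) \<le> (\<Sum>x\<in>C. X x ^ r * ((Y x + Z x) / 2))"
  shows "(\<Sum>x\<in>C. X x ^ Suc r) \<le> ((\<Sum>x\<in>C. Y x ^ Suc r) + (\<Sum>x\<in>C. Z x ^ Suc r)) / 2"
proof -
  have "Suc r * (\<Sum>x\<in>C. X x ^ Suc r) \<le> Suc r * (\<Sum>x\<in>C. X x ^ r * ((Y x + Z x) / 2))"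
    by (intro mult_left_mono le) simp
  also have "\<dots> = (\<Sum>x\<in>C. (Suc r * (X x ^ r * Y x) + Suc r * (X x ^ r * Z x)) / 2)"
    unfolding sum_distrib_left by (intro sum.cong refl) (simp add: field_simps)
  also have "\<dots> \<le> (\<Sum>x\<in>C. ((r * X x ^ Suc r + Y x ^ Suc r) + (r * X x ^ Suc r + Z x ^ Suc r)) / 2)"
    by (intro sum_mono divide_right_mono add_mono power_times_le_convex nonneg) auto
  also have "\<dots> = (\<Sum>x\<in>C. r * X x ^ Suc r + (Y x ^ Suc r + Z x ^ Suc r) / 2)"
    by (intro sum.cong refl) (simp add: field_simps)
  also have "\<dots> = r * (\<Sum>x\<in>C. X x ^ Suc r) + ((\<Sum>x\<in>C. Y x ^ Suc r) + (\<Sum>x\<in>C. Z x ^ Suc r)) / 2"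
    by (simp add: sum.distrib sum_distrib_left sum_divide_distrib[symmetric] del: power_Suc)
  finally show ?thesis by (simp add: algebra_simps del: power_Suc)
qed

section \<open>Difference operators on the cube\<close>

definition flip :: "nat \<Rightarrow> (nat \<Rightarrow> real) \<Rightarrow> nat \<Rightarrow> real" where
  "flip i x = x(i := - x i)"

definition half_diff :: "nat \<Rightarrow> ((nat \<Rightarrow> real) \<Rightarrow> real) \<Rightarrow> (nat \<Rightarrow> real) \<Rightarrow> real" where
  "half_diff i g x = (g x - g (flip i x)) / 2"

lemma flip_flip [simp]: "flip i (flip i x) = x"
  by (simp add: flip_def)

lemma flip_in_cube: "i \<in> {1..n} \<Longrightarrow> x \<in> cube n \<Longrightarrow> flip i x \<in> cube n"
  by (fastforce simp: flip_def cube_def PiE_iff extensional_def)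

lemma finite_cube [simp]: "finite (cube n)"
  unfolding cube_def by (intro finite_PiE) auto

lemma cube_coord: "x \<in> cube n \<Longrightarrow> i \<in> {1..n} \<Longrightarrow> x i \<in> {-1, 1}"
  by (auto simp: cube_def)

lemma cube_coord_square: "x \<in> cube n \<Longrightarrow> i \<in> {1..n} \<Longrightarrow> x i * x i = 1"
  using cube_coord[of x n i] by auto

lemma half_diff_flip: "half_diff i g (flip i x) = - half_diff i g x"
  by (simp add: half_diff_def field_simps)

lemma sum_cube_flip:
  "i \<in> {1..n} \<Longrightarrow> (\<Sum>x\<in>cube n. g (flip i x)) = (\<Sum>x\<in>cube n. g x)"
  by (rule sum.reindex_bij_witness[where i = "flip i" and j = "flip i"]) (auto intro: flip_in_cube)

text \<open>Each \<open>half_diff i\<close> is the orthogonal projection onto the functions that are odd in the \<open>i\<close>-th coordinate.\<close>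

lemma sum_half_diff_self_adjoint:
  assumes "i \<in> {1..n}"
  shows "(\<Sum>x\<in>cube n. g x * half_diff i h x) = (\<Sum>x\<in>cube n. half_diff i g x * half_diff i h x)"
proof -
  have "(\<Sum>x\<in>cube n. g x * half_diff i h x)
      = ((\<Sum>x\<in>cube n. g x * half_diff i h x) + (\<Sum>x\<in>cube n. g (flip i x) * half_diff i h (flip i x))) / 2"
    using sum_cube_flip[OF assms, of "\<lambda>x. g x * half_diff i h x"] by simp
  also have "\<dots> = (\<Sum>x\<in>cube n. half_diff i g x * half_diff i h x)"
    unfolding sum.distrib[symmetric] sum_divide_distrib
    by (intro sum.cong refl) (simp add: half_diff_flip, simp add: half_diff_def field_simps)
  finally show ?thesis .
qed

text \<open>The operator \<open>u \<mapsto> u + N u\<close> with \<open>N = \<Sum>\<^sub>i D\<^sub>i\<close> can only increase even moments. Testing the equation against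
  \<open>|u|\<^bsup>2r\<^esup> u\<close>, the part with \<open>N\<close> contributes a nonnegative amount for every \<open>i\<close>, as \<open>D\<^sub>i\<close> is a projection and
  \<open>a \<mapsto> |a|\<^bsup>2r\<^esup> a\<close> is monotone.\<close>

lemma resolvent_contraction:
  fixes u v :: "'k \<Rightarrow> (nat \<Rightarrow> real) \<Rightarrow> real"
  assumes eq: "\<And>k x. k \<in> K \<Longrightarrow> x \<in> cube n \<Longrightarrow> u k x + (\<Sum>i=1..n. half_diff i (u k) x) = v k x"
  shows "(\<Sum>x\<in>cube n. (\<Sum>k\<in>K. (u k x)\<^sup>2) ^ Suc r) \<le> (\<Sum>x\<in>cube n. (\<Sum>k\<in>K. (v k x)\<^sup>2) ^ Suc r)"
proof -
  define U V where "U x = (\<Sum>k\<in>K. (u k x)\<^sup>2)" and "V x = (\<Sum>k\<in>K. (v k x)\<^sup>2)" for x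
  have nonneg: "U x \<ge> 0" "V x \<ge> 0" for x
    by (simp_all add: U_def V_def sum_nonneg)
  have monotone: "0 \<le> (\<Sum>x\<in>cube n. \<Sum>k\<in>K. U x ^ r * u k x * half_diff i (u k) x)"
    if i: "i \<in> {1..n}" for i
  proof -
    have "(\<Sum>x\<in>cube n. \<Sum>k\<in>K. U x ^ r * u k x * half_diff i (u k) x)
        = (\<Sum>k\<in>K. \<Sum>x\<in>cube n. half_diff i (\<lambda>x. U x ^ r * u k x) x * half_diff i (u k) x)"
      by (subst sum.swap) (rule sum.cong[OF refl], rule sum_half_diff_self_adjoint[OF i])
    also have "\<dots> = (\<Sum>x\<in>cube n. (\<Sum>k\<in>K.
        (U x ^ r * u k x - U (flip i x) ^ r * u k (flip i x)) * (u k x - u k (flip i x))) / 4)"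
      by (subst sum.swap) (simp add: half_diff_def sum_divide_distrib)
    also have "\<dots> \<ge> 0"
      unfolding U_def by (intro sum_nonneg divide_nonneg_pos power_vector_diff_inner_nonneg) simp
    finally show ?thesis .
  qed
  have "(\<Sum>x\<in>cube n. U x ^ Suc r) = (\<Sum>x\<in>cube n. \<Sum>k\<in>K. U x ^ r * u k x * u k x)"
    by (simp add: U_def sum_distrib_left sum_distrib_right power2_eq_square mult_ac)
  also have "\<dots> \<le> (\<Sum>x\<in>cube n. \<Sum>k\<in>K. U x ^ r * u k x * u k x)
      + (\<Sum>i=1..n. \<Sum>x\<in>cube n. \<Sum>k\<in>K. U x ^ r * u k x * half_diff i (u k) x)"
    using sum_nonneg[of "{1..n}", OF monotone] by simp
  also have "\<dots> = (\<Sum>x\<in>cube n. (\<Sum>k\<in>K. U x ^ r * u k x * u k x)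
      + (\<Sum>k\<in>K. \<Sum>i=1..n. U x ^ r * u k x * half_diff i (u k) x))"
    unfolding sum.distrib
    by (subst sum.swap) (intro arg_cong2[of _ _ _ _ "(+)"] refl sum.cong, rule sum.swap)
  also have "\<dots> = (\<Sum>x\<in>cube n. \<Sum>k\<in>K. U x ^ r * (u k x * v k x))"
    by (intro sum.cong refl)
      (simp add: eq[symmetric] sum.distrib sum_distrib_left distrib_left mult.assoc)
  also have "\<dots> \<le> (\<Sum>x\<in>cube n. \<Sum>k\<in>K. U x ^ r * (((u k x)\<^sup>2 + (v k x)\<^sup>2) / 2))"
    by (intro sum_mono mult_left_mono zero_le_power nonneg mult_le_half_squares)
  also have "\<dots> = (\<Sum>x\<in>cube n. U x ^ r * ((U x + V x) / 2))"
    by (simp add: U_def V_def sum.distrib sum_distrib_left[symmetric] sum_divide_distrib[symmetric])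
  finally have "(\<Sum>x\<in>cube n. U x ^ Suc r) \<le> ((\<Sum>x\<in>cube n. U x ^ Suc r) + (\<Sum>x\<in>cube n. V x ^ Suc r)) / 2"
    by (rule sum_power_absorb[rotated -1]) (rule nonneg)+
  then show ?thesis by (simp add: U_def V_def del: power_Suc)
qed

section \<open>Walsh expansions\<close>

definition walsh :: "nat \<Rightarrow> (nat set \<Rightarrow> real) \<Rightarrow> (nat \<Rightarrow> real) \<Rightarrow> real" where
  "walsh n c x = (\<Sum>S\<in>Pow {1..n}. c S * (\<Prod>i\<in>S. x i))"

text \<open>The Walsh coefficients of the partial derivative in direction \<open>i\<close>, that is, of half the difference of the
  values at \<open>x\<^sub>i = 1\<close> and \<open>x\<^sub>i = -1\<close>.\<close>

definition partial_coeff :: "nat \<Rightarrow> (nat set \<Rightarrow> real) \<Rightarrow> nat set \<Rightarrow> real" where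
  "partial_coeff i c S = (if i \<in> S then 0 else c (insert i S))"

text \<open>A flip of the \<open>i\<close>-th sign negates precisely the monomials that contain \<open>x\<^sub>i\<close>.\<close>

lemma half_diff_walsh:
  "half_diff i (walsh n c) x = walsh n (\<lambda>S. if i \<in> S then c S else 0) x"
proof -
  have flip: "(\<Prod>j\<in>S. flip i x j) = (if i \<in> S then - 1 else 1) * (\<Prod>j\<in>S. x j)"
    if "S \<in> Pow {1..n}" for S
  proof -
    have fin: "finite S" using that finite_subset by auto
    have *: "(\<Prod>j\<in>T. flip i x j) = (\<Prod>j\<in>T. x j)" if "i \<notin> T" for T
      using that by (intro prod.cong) (auto simp: flip_def)
    show ?thesis
    proof (cases "i \<in> S")
      case True
      have "(\<Prod>j\<in>S. flip i x j) = flip i x i * (\<Prod>j\<in>S - {i}. flip i x j)"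
        using True fin by (rule prod.remove[rotated])
      also have "\<dots> = - (x i * (\<Prod>j\<in>S - {i}. x j))"
        by (simp add: * flip_def[of i x] del: fun_upd_apply) (simp add: flip_def)
      also have "\<dots> = - (\<Prod>j\<in>S. x j)"
        using prod.remove[OF fin True, of x] by simp
      finally show ?thesis using True by simp
    qed (simp add: *)
  qed
  show ?thesis
    unfolding half_diff_def walsh_def sum_subtractf[symmetric] sum_divide_distrib
    by (intro sum.cong refl) (simp add: flip)
qed

lemma sum_half_diff_walsh:
  "(\<Sum>i=1..n. half_diff i (walsh n c) x) = walsh n (\<lambda>S. real (card S) * c S) x"
proof -
  have "(\<Sum>i=1..n. half_diff i (walsh n c) x)
      = (\<Sum>S\<in>Pow {1..n}. (\<Sum>i=1..n. if i \<in> S then 1 else 0) * (c S * (\<Prod>i\<in>S. x i)))"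
    unfolding half_diff_walsh walsh_def sum_distrib_right
    by (subst sum.swap) (intro sum.cong refl, simp)
  also have "\<dots> = walsh n (\<lambda>S. real (card S) * c S) x"
    unfolding walsh_def
  proof (intro sum.cong refl)
    fix S assume S: "S \<in> Pow {1..n}"
    then have "{1..n} \<inter> S = S" by auto
    then have "(\<Sum>i=1..n. if i \<in> S then 1 else 0) = real (card S)"
      by (simp add: sum.If_cases)
    then show "(\<Sum>i=1..n. if i \<in> S then 1 else 0) * (c S * (\<Prod>i\<in>S. x i))
        = card S * c S * (\<Prod>i\<in>S. x i)" by simp
  qed
  finally show ?thesis .
qed

text \<open>Multiplication by the sign \<open>x\<^sub>i\<close> turns a difference into a partial derivative and removes its dependence
  on \<open>x\<^sub>i\<close>, as \<open>x\<^sub>i\<^sup>2 = 1\<close>.\<close>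

lemma coord_times_half_diff_walsh:
  assumes "x \<in> cube n" "i \<in> {1..n}"
  shows "x i * half_diff i (walsh n c) x = walsh n (partial_coeff i c) x"
proof -
  have "x i * half_diff i (walsh n c) x
      = (\<Sum>S\<in>Pow {1..n}. if i \<in> S then x i * (c S * (\<Prod>j\<in>S. x j)) else 0)"
    unfolding half_diff_walsh walsh_def sum_distrib_left by (intro sum.cong refl) simp
  also have "\<dots> = (\<Sum>S | S \<in> Pow {1..n} \<and> i \<in> S. x i * (c S * (\<Prod>j\<in>S. x j)))"
    by (rule sum.inter_filter[symmetric]) simp
  also have "\<dots> = (\<Sum>S | S \<in> Pow {1..n} \<and> i \<notin> S. c (insert i S) * (\<Prod>j\<in>S. x j))"
  proof (rule sum.reindex_bij_witness[where i = "insert i" and j = "\<lambda>S. S - {i}"])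
    fix S assume S: "S \<in> {S. S \<in> Pow {1..n} \<and> i \<in> S}"
    then have "finite S" using finite_subset by auto
    then have "(\<Prod>j\<in>S. x j) = x i * (\<Prod>j\<in>S - {i}. x j)"
      using S by (intro prod.remove) auto
    moreover have "insert i (S - {i}) = S" using S by auto
    ultimately show "c (insert i (S - {i})) * (\<Prod>j\<in>S - {i}. x j) = x i * (c S * (\<Prod>j\<in>S. x j))"
      using cube_coord_square[OF assms] by simp
  qed (use assms in auto)
  also have "\<dots> = (\<Sum>S\<in>Pow {1..n}. if i \<notin> S then c (insert i S) * (\<Prod>j\<in>S. x j) else 0)"
    by (rule sum.inter_filter) simp
  also have "\<dots> = walsh n (partial_coeff i c) x"
    unfolding walsh_def by (intro sum.cong refl) (simp add: partial_coeff_def)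
  finally show ?thesis .
qed

lemma half_diff_walsh_square:
  assumes "x \<in> cube n" "i \<in> {1..n}"
  shows "(half_diff i (walsh n c) x)\<^sup>2 = (walsh n (partial_coeff i c) x)\<^sup>2"
  using cube_coord[OF assms] by (auto simp: coord_times_half_diff_walsh[OF assms, symmetric])

section \<open>Moments of mean-zero functions\<close>

text \<open>With \<open>p = 2 (r + 1)\<close>, this is \<open>E |F|\<^bsup>p\<^esup> \<le> (p - 1)\<^bsup>p/2\<^esup> E |DF|\<^bsup>p\<^esup>\<close> for \<open>F\<close> with components indexed by \<open>K\<close>,
  multiplied by the number of points of the cube.
  The vector-valued form matters: it is needed for the gradient of a function, and the constant must not
  depend on the number of components.\<close>

lemma moment_poincare:
  fixes c :: "'k \<Rightarrow> nat set \<Rightarrow> real"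
  assumes mean_zero: "\<And>k. k \<in> K \<Longrightarrow> c k {} = 0"
  shows "(\<Sum>x\<in>cube n. (\<Sum>k\<in>K. (walsh n (c k) x)\<^sup>2) ^ Suc r)
    \<le> real (2 * r + 1) ^ Suc r *
      (\<Sum>x\<in>cube n. (\<Sum>i=1..n. \<Sum>k\<in>K. (half_diff i (walsh n (c k)) x)\<^sup>2) ^ Suc r)"
proof -
  \<comment> \<open>\<open>G\<close> is the preimage of \<open>F\<close> under \<open>\<Sum>\<^sub>i D\<^sub>i\<close>; division by \<open>card {} = 0\<close> is harmless as \<open>c k {} = 0\<close>.\<close>
  define F G where "F k = walsh n (c k)" and "G k = walsh n (\<lambda>S. c k S / card S)" for k
  define Q where "Q x = (\<Sum>k\<in>K. (F k x)\<^sup>2)" for x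
  define dF dG where "dF i x = (\<Sum>k\<in>K. (half_diff i (F k) x)\<^sup>2)"
    and "dG i x = (\<Sum>k\<in>K. (half_diff i (G k) x)\<^sup>2)" for i x
  define DF DG where "DF x = (\<Sum>i=1..n. dF i x)" and "DG x = (\<Sum>i=1..n. dG i x)" for x
  have nonneg: "Q x \<ge> 0" "DF x \<ge> 0" "DG x \<ge> 0" for x
    by (simp_all add: Q_def DF_def DG_def dF_def dG_def sum_nonneg)
  have F_eq: "F k x = (\<Sum>i=1..n. half_diff i (G k) x)" if "k \<in> K" for k x
    unfolding F_def G_def sum_half_diff_walsh walsh_def
  proof (intro sum.cong refl)
    fix S assume "S \<in> Pow {1..n}"
    then have "finite S" using finite_subset by auto
    then have "c k S = card S * (c k S / card S)"
      using mean_zero[OF that] by (cases "S = {}") auto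
    then show "c k S * (\<Prod>i\<in>S. x i) = card S * (c k S / card S) * (\<Prod>i\<in>S. x i)" by simp
  qed
  have step: "(\<Sum>x\<in>cube n. \<Sum>k\<in>K. Q x ^ r * F k x * half_diff i (G k) x)
      \<le> (\<Sum>x\<in>cube n. Q x ^ r * (real (2 * r + 1) * (dF i x + dG i x) / 2))" if i: "i \<in> {1..n}" for i
  proof -
    \<comment> \<open>Invariant under the \<open>i\<close>-th flip, so the two endpoints \<open>x\<close> and \<open>flip i x\<close> contribute equally to the sum.\<close>
    let ?h = "\<lambda>x. real (2 * r + 1) * (dF i x + dG i x) / 4"
    have inv: "?h (flip i x) = ?h x" for x
      by (simp add: dF_def dG_def half_diff_flip)
    have "(\<Sum>x\<in>cube n. \<Sum>k\<in>K. Q x ^ r * F k x * half_diff i (G k) x)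
        = (\<Sum>k\<in>K. \<Sum>x\<in>cube n. half_diff i (\<lambda>x. Q x ^ r * F k x) x * half_diff i (G k) x)"
      by (subst sum.swap) (rule sum.cong[OF refl], rule sum_half_diff_self_adjoint[OF i])
    also have "\<dots> = (\<Sum>x\<in>cube n. (\<Sum>k\<in>K.
        (Q x ^ r * F k x - Q (flip i x) ^ r * F k (flip i x)) * (2 * half_diff i (G k) x)) / 4)"
      unfolding sum_divide_distrib
      by (subst sum.swap) (intro sum.cong refl, simp add: half_diff_def[of i "\<lambda>x. Q x ^ r * _ x"])
    also have "\<dots> \<le> (\<Sum>x\<in>cube n. (real (2 * r + 1) / 4 * (Q x ^ r + Q (flip i x) ^ r) *
        ((\<Sum>k\<in>K. (F k x - F k (flip i x))\<^sup>2) + (\<Sum>k\<in>K. (2 * half_diff i (G k) x)\<^sup>2))) / 4)"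
      unfolding Q_def by (intro sum_mono divide_right_mono power_vector_diff_inner_le) simp
    also have "\<dots> = (\<Sum>x\<in>cube n. Q x ^ r * ?h x + Q (flip i x) ^ r * ?h (flip i x))"
    proof (intro sum.cong refl)
      fix x
      have "(\<Sum>k\<in>K. (F k x - F k (flip i x))\<^sup>2) = 4 * dF i x"
        unfolding dF_def sum_distrib_left by (intro sum.cong refl) (simp add: half_diff_def power_divide)
      moreover have "(\<Sum>k\<in>K. (2 * half_diff i (G k) x)\<^sup>2) = 4 * dG i x"
        unfolding dG_def sum_distrib_left by (intro sum.cong refl) (simp add: power_mult_distrib)
      moreover have "t / 4 * (p + q) * (4 * d + 4 * e) / 4 = p * (t * (d + e) / 4) + q * (t * (d + e) / 4)"
        for t p q d e :: real
        by (simp add: algebra_simps add_divide_distrib)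
      ultimately show "(real (2 * r + 1) / 4 * (Q x ^ r + Q (flip i x) ^ r) *
          ((\<Sum>k\<in>K. (F k x - F k (flip i x))\<^sup>2) + (\<Sum>k\<in>K. (2 * half_diff i (G k) x)\<^sup>2))) / 4
          = Q x ^ r * ?h x + Q (flip i x) ^ r * ?h (flip i x)"
        unfolding inv by (simp only:)
    qed
    also have "\<dots> = 2 * (\<Sum>x\<in>cube n. Q x ^ r * ?h x)"
      unfolding sum.distrib sum_cube_flip[OF i, of "\<lambda>x. Q x ^ r * ?h x"] by simp
    also have "\<dots> = (\<Sum>x\<in>cube n. Q x ^ r * (real (2 * r + 1) * (dF i x + dG i x) / 2))"
      unfolding sum_distrib_left by (intro sum.cong refl) simp
    finally show ?thesis .
  qed
  have "(\<Sum>x\<in>cube n. Q x ^ Suc r)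
      = (\<Sum>x\<in>cube n. \<Sum>k\<in>K. \<Sum>i=1..n. Q x ^ r * F k x * half_diff i (G k) x)"
  proof (intro sum.cong refl)
    fix x
    have "Q x ^ Suc r = (\<Sum>k\<in>K. Q x ^ r * F k x * F k x)"
      by (simp add: Q_def sum_distrib_left sum_distrib_right power2_eq_square mult_ac)
    also have "\<dots> = (\<Sum>k\<in>K. Q x ^ r * F k x * (\<Sum>i=1..n. half_diff i (G k) x))"
      by (intro sum.cong refl arg_cong2[of _ _ _ _ "(*)"] F_eq)
    finally show "Q x ^ Suc r = (\<Sum>k\<in>K. \<Sum>i=1..n. Q x ^ r * F k x * half_diff i (G k) x)"
      by (simp add: sum_distrib_left)
  qed
  also have "\<dots> = (\<Sum>x\<in>cube n. \<Sum>i=1..n. \<Sum>k\<in>K. Q x ^ r * F k x * half_diff i (G k) x)"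
    by (intro sum.cong refl sum.swap)
  also have "\<dots> = (\<Sum>i=1..n. \<Sum>x\<in>cube n. \<Sum>k\<in>K. Q x ^ r * F k x * half_diff i (G k) x)"
    by (rule sum.swap)
  also have "\<dots> \<le> (\<Sum>i=1..n. \<Sum>x\<in>cube n. Q x ^ r * (real (2 * r + 1) * (dF i x + dG i x) / 2))"
    by (intro sum_mono step)
  also have "\<dots> = (\<Sum>x\<in>cube n. Q x ^ r * ((real (2 * r + 1) * DF x + real (2 * r + 1) * DG x) / 2))"
    by (subst sum.swap)
      (simp add: DF_def DG_def sum_distrib_left[symmetric] sum_divide_distrib[symmetric] sum.distrib distrib_left)
  finally have "(\<Sum>x\<in>cube n. Q x ^ Suc r)
      \<le> ((\<Sum>x\<in>cube n. (real (2 * r + 1) * DF x) ^ Suc r) + (\<Sum>x\<in>cube n. (real (2 * r + 1) * DG x) ^ Suc r)) / 2"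
    by (rule sum_power_absorb[rotated -1]) (simp_all add: nonneg)
  also have "\<dots> = real (2 * r + 1) ^ Suc r * (((\<Sum>x\<in>cube n. DF x ^ Suc r) + (\<Sum>x\<in>cube n. DG x ^ Suc r)) / 2)"
    unfolding power_mult_distrib sum_distrib_left[symmetric] by (simp add: field_simps)
  also have "(\<Sum>x\<in>cube n. DG x ^ Suc r) \<le> (\<Sum>x\<in>cube n. DF x ^ Suc r)"
  proof -
    \<comment> \<open>The monomial of \<open>S\<close> becomes one of degree \<open>card S - 1\<close>, so division by \<open>card S\<close> is exactly the resolvent
      of the number operator on partial derivatives.\<close>
    let ?u = "\<lambda>(i, k). walsh n (partial_coeff i (\<lambda>S. c k S / card S))"
    let ?v = "\<lambda>(i, k). walsh n (partial_coeff i (c k))"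
    have "(\<Sum>x\<in>cube n. (\<Sum>p\<in>{1..n} \<times> K. (?u p x)\<^sup>2) ^ Suc r)
        \<le> (\<Sum>x\<in>cube n. (\<Sum>p\<in>{1..n} \<times> K. (?v p x)\<^sup>2) ^ Suc r)"
    proof (rule resolvent_contraction, clarify)
      fix i k x
      show "walsh n (partial_coeff i (\<lambda>S. c k S / card S)) x
          + (\<Sum>j=1..n. half_diff j (walsh n (partial_coeff i (\<lambda>S. c k S / card S))) x)
          = walsh n (partial_coeff i (c k)) x"
        unfolding sum_half_diff_walsh walsh_def sum.distrib[symmetric]
      proof (intro sum.cong refl)
        fix S assume "S \<in> Pow {1..n}"
        then have "finite S" using finite_subset by auto
        have cancel: "a / (1 + real m) + real m * (a / (1 + real m)) = a" for a m
        proof -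
          have "a / (1 + real m) + real m * (a / (1 + real m)) = (1 + real m) * (a / (1 + real m))"
            by (simp only: distrib_right mult_1)
          then show ?thesis by simp
        qed
        from \<open>finite S\<close> have "partial_coeff i (\<lambda>S. c k S / card S) S + card S * partial_coeff i (\<lambda>S. c k S / card S) S
            = partial_coeff i (c k) S"
          using cancel[of "c k (insert i S)" "card S"] by (simp add: partial_coeff_def)
        then show "partial_coeff i (\<lambda>S. c k S / card S) S * (\<Prod>i\<in>S. x i)
            + card S * partial_coeff i (\<lambda>S. c k S / card S) S * (\<Prod>i\<in>S. x i)
            = partial_coeff i (c k) S * (\<Prod>i\<in>S. x i)"
          by (metis distrib_right)
      qed
    qed
    moreover have "(\<Sum>p\<in>{1..n} \<times> K. (?u p x)\<^sup>2) = DG x" "(\<Sum>p\<in>{1..n} \<times> K. (?v p x)\<^sup>2) = DF x"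
      if "x \<in> cube n" for x
      unfolding DG_def DF_def dF_def dG_def F_def G_def sum.cartesian_product
      by (intro sum.cong refl; auto simp: half_diff_walsh_square[OF that])+
    ultimately show ?thesis by (simp del: power_Suc)
  qed
  finally show ?thesis
    by (simp add: Q_def DF_def dF_def F_def mult_left_mono del: power_Suc)
qed

text \<open>Without constant and linear terms, both the function and its partial derivatives have mean zero, so that
  the Poincare-type inequality can be iterated. The partial derivatives, rather than the differences
  themselves, are used in the second step because the \<open>i\<close>-th difference of \<open>D\<^sub>i f\<close> is \<open>D\<^sub>i f\<close> again, whereas
  that of \<open>x\<^sub>i D\<^sub>i f\<close> is zero.\<close>

lemma moment_second_order:
  assumes low: "\<And>S. card S < 2 \<Longrightarrow> c S = 0"
  shows "(\<Sum>x\<in>cube n. walsh n c x ^ (2 * Suc r))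
    \<le> real (2 * r + 1) ^ (2 * Suc r) *
      (\<Sum>x\<in>cube n. HS_norm n (diff2_matrix (\<lambda>_. symm_bernoulli) (walsh n c) x) ^ (2 * Suc r))"
proof -
  let ?g = "\<lambda>i. walsh n (partial_coeff i c)"
  have "(\<Sum>x\<in>cube n. walsh n c x ^ (2 * Suc r)) = (\<Sum>x\<in>cube n. (\<Sum>k\<in>{()}. (walsh n c x)\<^sup>2) ^ Suc r)"
    by (simp only: power_mult) simp
  also have "\<dots> \<le> real (2 * r + 1) ^ Suc r *
      (\<Sum>x\<in>cube n. (\<Sum>i=1..n. \<Sum>k\<in>{()}. (half_diff i (walsh n c) x)\<^sup>2) ^ Suc r)"
    by (rule moment_poincare) (simp add: low)
  also have "(\<Sum>x\<in>cube n. (\<Sum>i=1..n. \<Sum>k\<in>{()}. (half_diff i (walsh n c) x)\<^sup>2) ^ Suc r)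
      = (\<Sum>x\<in>cube n. (\<Sum>i=1..n. (?g i x)\<^sup>2) ^ Suc r)"
    by (intro sum.cong refl arg_cong2[of _ _ _ _ "(^)"]) (simp add: half_diff_walsh_square)
  finally have first: "(\<Sum>x\<in>cube n. walsh n c x ^ (2 * Suc r))
      \<le> real (2 * r + 1) ^ Suc r * (\<Sum>x\<in>cube n. (\<Sum>i=1..n. (?g i x)\<^sup>2) ^ Suc r)" .
  have "(\<Sum>x\<in>cube n. (\<Sum>i=1..n. (?g i x)\<^sup>2) ^ Suc r) \<le> real (2 * r + 1) ^ Suc r *
      (\<Sum>x\<in>cube n. (\<Sum>j=1..n. \<Sum>i=1..n. (half_diff j (?g i) x)\<^sup>2) ^ Suc r)"
    by (rule moment_poincare) (simp add: low partial_coeff_def)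
  also have "(\<Sum>x\<in>cube n. (\<Sum>j=1..n. \<Sum>i=1..n. (half_diff j (?g i) x)\<^sup>2) ^ Suc r)
      = (\<Sum>x\<in>cube n. HS_norm n (diff2_matrix (\<lambda>_. symm_bernoulli) (walsh n c) x) ^ (2 * Suc r))"
  proof (intro sum.cong refl)
    fix x assume x: "x \<in> cube n"
    have D: "diff_op (\<lambda>_. symm_bernoulli) i h y = half_diff i h y"
      if "y \<in> cube n" "i \<in> {1..n}" for i h y
      using diff_op_symm_bernoulli[of y i h] cube_coord[OF that] by (simp add: half_diff_def flip_def)
    have entry: "\<bar>diff2_matrix (\<lambda>_. symm_bernoulli) (walsh n c) x j i\<bar>\<^sup>2 = (half_diff j (?g i) x)\<^sup>2"
      if i: "i \<in> {1..n}" and j: "j \<in> {1..n}" for i j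
    proof (cases "i = j")
      case True
      have "half_diff i (?g i) x = 0"
        unfolding half_diff_walsh walsh_def by (intro sum.neutral) (simp add: partial_coeff_def)
      then show ?thesis using True by (simp add: diff2_matrix_def)
    next
      case False
      have "flip j x \<in> cube n" using x j by (rule flip_in_cube[rotated])
      moreover have "flip j x i = x i" using False by (simp add: flip_def)
      ultimately have "x i * diff2_matrix (\<lambda>_. symm_bernoulli) (walsh n c) x j i = half_diff j (?g i) x"
        using False x i j coord_times_half_diff_walsh[of x n i c] coord_times_half_diff_walsh[of "flip j x" n i c]
        by (simp add: diff2_matrix_def D half_diff_def[of j] algebra_simps)
      then show ?thesis using cube_coord[OF x i]
        by (metis insertE mult_1 mult_minus1 power2_abs power2_minus singletonD)
    qed
    have "(HS_norm n (diff2_matrix (\<lambda>_. symm_bernoulli) (walsh n c) x))\<^sup>2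
        = (\<Sum>j=1..n. \<Sum>i=1..n. \<bar>diff2_matrix (\<lambda>_. symm_bernoulli) (walsh n c) x j i\<bar>\<^sup>2)"
      unfolding HS_norm_def by (intro real_sqrt_pow2 sum_nonneg) simp
    also have "\<dots> = (\<Sum>j=1..n. \<Sum>i=1..n. (half_diff j (?g i) x)\<^sup>2)"
      by (intro sum.cong refl entry)
    finally show "(\<Sum>j=1..n. \<Sum>i=1..n. (half_diff j (?g i) x)\<^sup>2) ^ Suc r
        = HS_norm n (diff2_matrix (\<lambda>_. symm_bernoulli) (walsh n c) x) ^ (2 * Suc r)"
      by (simp only: power_mult)
  qed
  finally have second: "(\<Sum>x\<in>cube n. (\<Sum>i=1..n. (?g i x)\<^sup>2) ^ Suc r) \<le> real (2 * r + 1) ^ Suc r *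
      (\<Sum>x\<in>cube n. HS_norm n (diff2_matrix (\<lambda>_. symm_bernoulli) (walsh n c) x) ^ (2 * Suc r))" .
  have square: "real (2 * r + 1) ^ (2 * Suc r) = real (2 * r + 1) ^ Suc r * real (2 * r + 1) ^ Suc r"
    by (simp only: mult_2[of "Suc r"] power_add)
  show ?thesis
    unfolding square mult.assoc
    by (rule order_trans[OF first]) (intro mult_left_mono second, simp)
qed

section \<open>From moments to exponential integrability\<close>

lemma integral_cube_measure:
  "(\<integral>x. g x \<partial>cube_measure n) = (\<Sum>x\<in>cube n. g x) / 2 ^ n" for g :: "(nat \<Rightarrow> real) \<Rightarrow> real"
proof -
  interpret P: product_prob_space "\<lambda>_. symm_bernoulli" "{1..n}"
    by (rule product_prob_spaceI) (rule prob_space_symm_bernoulli)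
  interpret prob_space "cube_measure n"
    unfolding cube_measure_def by (rule prob_space_PiM) (rule prob_space_symm_bernoulli)
  have single: "measure (cube_measure n) {y} = 1 / 2 ^ n" if y: "y \<in> cube n" for y
  proof -
    have half: "(1/2 :: ennreal) = ennreal (1/2)"
      using divide_ennreal[of 1 2] by simp
    have "{y} = Pi\<^sub>E {1..n} (\<lambda>i. {y i})"
      using y by (simp add: cube_def PiE_singleton PiE_iff)
    then have "emeasure (cube_measure n) {y} = (\<Prod>i=1..n. emeasure symm_bernoulli {y i})"
      unfolding cube_measure_def using cube_coord[OF y]
      by (simp only:) (subst P.emeasure_PiM; simp add: symm_bernoulli_def sets_point_measure)
    also have "\<dots> = (\<Prod>i=1..n. ennreal (1/2))"
      using cube_coord[OF y]
      by (intro prod.cong refl) (simp add: symm_bernoulli_def emeasure_point_measure_finite half)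
    also have "\<dots> = ennreal (1 / 2 ^ n)"
      by (simp only: prod_constant ennreal_power) (simp add: power_one_over)
    finally show ?thesis by (simp add: measure_def)
  qed
  have "(\<integral>x. g x \<partial>cube_measure n) = (\<integral>x. (\<Sum>y\<in>cube n. g y * indicator {y} x) \<partial>cube_measure n)"
    by (intro Bochner_Integration.integral_cong refl)
      (simp add: space_cube_measure indicator_def if_distrib sum.delta cong: if_cong)
  also have "\<dots> = (\<Sum>y\<in>cube n. g y * measure (cube_measure n) {y})"
    by (subst Bochner_Integration.integral_sum)
      (auto intro!: integrable_cube_measure sum.cong simp: space_cube_measure Int_absorb1)
  also have "\<dots> = (\<Sum>x\<in>cube n. g x) / 2 ^ n"
    by (simp add: single sum_divide_distrib)
  finally show ?thesis .
qed

lemma card_cube: "card (cube n) = 2 ^ n"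
proof -
  have "{-1, 1 :: real} = {1, -1}" by auto
  then have "card {-1, 1 :: real} = 2" by simp
  then show ?thesis unfolding cube_def
    by (subst card_PiE) (simp_all only: prod_constant finite_atLeastAtMost card_atLeastAtMost diff_Suc_1)
qed

text \<open>From \<open>m\<^bsup>m\<^esup> / m! \<le> e\<^bsup>m\<^esup>\<close> with \<open>m = 2 r + 1\<close> and \<open>e \<le> 3\<close>.\<close>

lemma odd_power_div_fact_le: "real (2 * r + 1) ^ (2 * Suc r) / fact (2 * Suc r) \<le> 3 ^ (2 * r + 1)"
proof -
  define m where "m = 2 * r + 1"
  have "(\<Sum>k\<in>{m}. real m ^ k /\<^sub>R fact k) \<le> (\<Sum>k. real m ^ k /\<^sub>R fact k)"
    by (intro sum_le_suminf summable_exp_generic) auto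
  also have "\<dots> = exp (real m)" by (simp add: exp_def)
  finally have "real m ^ m / fact m \<le> exp (real m)" by (simp add: field_simps)
  also have "\<dots> = exp 1 ^ m" using exp_of_nat_mult[of m "1 :: real"] by simp
  also have "\<dots> \<le> 3 ^ m" by (intro power_mono exp_le) simp
  finally have le: "real m ^ m / fact m \<le> 3 ^ m" .
  have "real m ^ Suc m / fact (Suc m) = real m / real (Suc m) * (real m ^ m / fact m)"
    by simp
  also have "\<dots> \<le> 1 * 3 ^ m"
    using le by (intro mult_mono) auto
  finally show ?thesis by (simp add: m_def)
qed

lemma cosh_even_sums: "(\<lambda>m. y ^ (2 * m) / fact (2 * m)) sums cosh y" for y :: real
proof -
  have "(\<lambda>m. if even (2 * m) then y ^ (2 * m) /\<^sub>R fact (2 * m) else 0) sums cosh y"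
    by (subst sums_mono_reindex[where g = "\<lambda>m. 2 * m" and f = "\<lambda>n. if even n then y ^ n /\<^sub>R fact n else 0"])
      (auto simp: strict_mono_def cosh_converges elim!: evenE)
  then show ?thesis by (simp add: divide_inverse mult.commute)
qed

text \<open>The cruder bound \<open>2 cosh y\<close> would not do, as its expectation is at least 2. Using
  \<open>exp (- |y|) \<ge> 1 - |y|\<close> gains a constant at the price of a small second moment.\<close>

lemma exp_abs_le_cosh: "exp \<bar>y\<bar> \<le> 2 * cosh y - 1/2 + y\<^sup>2 / 2" for y :: real
proof -
  have "exp \<bar>y\<bar> + exp (- \<bar>y\<bar>) = 2 * cosh y"
    by (cases "y \<ge> 0") (simp_all add: cosh_def)
  moreover have "1 - \<bar>y\<bar> \<le> exp (- \<bar>y\<bar>)"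
    using exp_ge_add_one_self[of "- \<bar>y\<bar>"] by simp
  moreover have "\<bar>y\<bar> \<le> 1/2 + y\<^sup>2 / 2"
    using mult_le_half_squares[of 1 "\<bar>y\<bar>"] by simp
  ultimately show ?thesis by linarith
qed

text \<open>Even moments of order \<open>p\<close> bounded by \<open>((p - 1) / 5)\<^bsup>p\<^esup>\<close> give
  \<open>E cosh a \<le> 1 + \<Sum>\<^sub>r 3\<^bsup>2r+1\<^esup> / 25\<^bsup>r+1\<^esup> = 19/16\<close>, and then
  \<open>E exp |a| \<le> 2 * 19/16 - 1/2 + 1/50 < 2\<close>. The value \<open>1/50\<close> is half of the bound \<open>1/25\<close> for \<open>p = 2\<close>.\<close>

lemma exp_integrable_of_moments:
  assumes moment: "\<And>r. (\<Sum>x\<in>C. a x ^ (2 * Suc r)) \<le> real (card C) * (real (2 * r + 1) / 5) ^ (2 * Suc r)"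
  shows "(\<Sum>x\<in>C. exp \<bar>a x\<bar>) \<le> real (card C) * 2"
proof -
  define b :: "nat \<Rightarrow> real" where "b m = (case m of 0 \<Rightarrow> 1 | Suc r \<Rightarrow> 3/25 * (9/25) ^ r)" for m
  have "(\<lambda>r. 3/25 * (9/25 :: real) ^ r) sums (3/25 * (1 / (1 - 9/25)))"
    by (intro sums_mult geometric_sums) simp
  then have "(\<lambda>r. b (Suc r)) sums (3/16)"
    by (simp add: b_def)
  then have "b sums (3/16 + b 0)"
    by (rule sums_Suc)
  then have b: "b sums (19/16)"
    by (simp add: b_def)
  have "(\<Sum>x\<in>C. cosh (a x)) \<le> card C * (19/16)"
  proof (rule sums_le)
    show "(\<lambda>m. \<Sum>x\<in>C. a x ^ (2 * m) / fact (2 * m)) sums (\<Sum>x\<in>C. cosh (a x))"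
      by (intro sums_sum cosh_even_sums)
    show "(\<lambda>m. card C * b m) sums (card C * (19/16))"
      by (intro sums_mult b)
    fix m
    show "(\<Sum>x\<in>C. a x ^ (2 * m) / fact (2 * m)) \<le> card C * b m"
    proof (cases m)
      case 0
      then show ?thesis by (simp add: b_def)
    next
      case (Suc r)
      have "(\<Sum>x\<in>C. a x ^ (2 * Suc r) / fact (2 * Suc r))
          = (\<Sum>x\<in>C. a x ^ (2 * Suc r)) / fact (2 * Suc r)"
        by (simp only: sum_divide_distrib)
      also have "\<dots> \<le> card C * (real (2 * r + 1) / 5) ^ (2 * Suc r) / fact (2 * Suc r)"
        by (intro divide_right_mono moment) simp
      also have "\<dots> = card C * (1 / 5 ^ (2 * Suc r)) * (real (2 * r + 1) ^ (2 * Suc r) / fact (2 * Suc r))"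
        by (simp only: power_divide) simp
      also have "\<dots> \<le> card C * (1 / 5 ^ (2 * Suc r)) * 3 ^ (2 * r + 1)"
        by (intro mult_left_mono odd_power_div_fact_le) simp
      also have "\<dots> = card C * b m"
        by (simp add: b_def Suc power_mult power_divide)
      finally show ?thesis by (simp only: Suc)
    qed
  qed
  moreover have "(\<Sum>x\<in>C. (a x)\<^sup>2) \<le> card C * (1/25)"
    using moment[of 0] by (simp add: power_divide)
  moreover have "(\<Sum>x\<in>C. exp \<bar>a x\<bar>) \<le> (\<Sum>x\<in>C. 2 * cosh (a x) - 1/2 + (a x)\<^sup>2 / 2)"
    by (intro sum_mono exp_abs_le_cosh)
  moreover have "(\<Sum>x\<in>C. 2 * cosh (a x) - 1/2 + (a x)\<^sup>2 / 2)
      = 2 * (\<Sum>x\<in>C. cosh (a x)) - card C / 2 + (\<Sum>x\<in>C. (a x)\<^sup>2) / 2"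
    by (simp add: sum.distrib sum_subtractf sum_distrib_left[symmetric] sum_divide_distrib[symmetric])
  ultimately show ?thesis by simp
qed

lemma tetrahedral_poly_eq_walsh:
  "tetrahedral_poly n \<alpha> = walsh n (\<lambda>S. if card S < 2 then 0 else \<alpha> S)"
proof
  fix x
  let ?t = "\<lambda>S. \<alpha> S * (\<Prod>i\<in>S. x i)"
  have "tetrahedral_poly n \<alpha> x = (\<Sum>d=2..n. \<Sum>S | S \<in> {S \<in> Pow {1..n}. 2 \<le> card S} \<and> card S = d. ?t S)"
    unfolding tetrahedral_poly_def by (intro sum.cong refl) auto
  also have "\<dots> = (\<Sum>S | S \<in> Pow {1..n} \<and> 2 \<le> card S. ?t S)"
  proof (rule sum.group)
    show "card ` {S \<in> Pow {1..n}. 2 \<le> card S} \<subseteq> {2..n}"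
      using card_mono[of "{1..n}"] by fastforce
  qed auto
  also have "\<dots> = (\<Sum>S\<in>Pow {1..n}. if 2 \<le> card S then ?t S else 0)"
    by (rule sum.inter_filter) simp
  also have "\<dots> = walsh n (\<lambda>S. if card S < 2 then 0 else \<alpha> S) x"
    unfolding walsh_def by (intro sum.cong refl) simp
  finally show "tetrahedral_poly n \<alpha> x = walsh n (\<lambda>S. if card S < 2 then 0 else \<alpha> S) x" .
qed

theorem proposition6p2:
  fixes n :: nat and \<alpha> :: "nat set \<Rightarrow> real" and f :: "(nat \<Rightarrow> real) \<Rightarrow> real" and B :: real
  assumes "f = tetrahedral_poly n \<alpha>"
    and "B = (SUP x\<in>cube n. HS_norm n (diff2_matrix (\<lambda>_. symm_bernoulli) f x))"
  shows "(\<integral>x. exp (1 / (5 * B) * \<bar>f x\<bar>) \<partial>cube_measure n) \<le> 2"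
proof -
  let ?H = "\<lambda>x. HS_norm n (diff2_matrix (\<lambda>_. symm_bernoulli) f x)"
  define c where "c S = (if card S < 2 then 0 else \<alpha> S)" for S
  have f: "f = walsh n c"
    unfolding assms(1) c_def by (rule tetrahedral_poly_eq_walsh)
  have H: "0 \<le> ?H x" "?H x \<le> B" if "x \<in> cube n" for x
    unfolding assms(2) using that
    by (auto simp: HS_norm_def intro!: sum_nonneg cSUP_upper bdd_above_finite)
  have "(\<lambda>i\<in>{1..n}. 1) \<in> cube n" by (simp add: cube_def)
  then have "B \<ge> 0" using H by (metis order_trans)
  have moment: "(\<Sum>x\<in>cube n. f x ^ (2 * Suc r)) \<le> card (cube n) * (real (2 * r + 1) * B) ^ (2 * Suc r)" for r
  proof -
    have "(\<Sum>x\<in>cube n. f x ^ (2 * Suc r)) \<le> real (2 * r + 1) ^ (2 * Suc r) * (\<Sum>x\<in>cube n. ?H x ^ (2 * Suc r))"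
      unfolding f by (rule moment_second_order) (simp add: c_def)
    also have "\<dots> \<le> real (2 * r + 1) ^ (2 * Suc r) * (\<Sum>x\<in>cube n. B ^ (2 * Suc r))"
      by (intro mult_left_mono sum_mono power_mono H) auto
    also have "\<dots> = card (cube n) * (real (2 * r + 1) * B) ^ (2 * Suc r)"
      by (simp only: power_mult_distrib sum_constant) simp
    finally show ?thesis .
  qed
  have "(\<Sum>x\<in>cube n. exp \<bar>1 / (5 * B) * f x\<bar>) \<le> real (card (cube n)) * 2"
  proof (rule exp_integrable_of_moments)
    fix r
    have "(\<Sum>x\<in>cube n. (1 / (5 * B) * f x) ^ (2 * Suc r))
        = (1 / (5 * B)) ^ (2 * Suc r) * (\<Sum>x\<in>cube n. f x ^ (2 * Suc r))"
      by (simp only: power_mult_distrib sum_distrib_left)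
    also have "\<dots> \<le> (1 / (5 * B)) ^ (2 * Suc r) * (card (cube n) * (real (2 * r + 1) * B) ^ (2 * Suc r))"
      using \<open>B \<ge> 0\<close> by (intro mult_left_mono moment) simp
    also have "\<dots> = card (cube n) * (1 / (5 * B) * (real (2 * r + 1) * B)) ^ (2 * Suc r)"
      by (simp only: power_mult_distrib) simp
    also have "\<dots> \<le> card (cube n) * (real (2 * r + 1) / 5) ^ (2 * Suc r)"
      \<comment> \<open>An equality for \<open>B > 0\<close>; for \<open>B = 0\<close> the left side is zero by the convention \<open>1 / 0 = 0\<close>.\<close>
      using \<open>B \<ge> 0\<close> by (intro mult_left_mono power_mono) auto
    finally show "(\<Sum>x\<in>cube n. (1 / (5 * B) * f x) ^ (2 * Suc r))
        \<le> card (cube n) * (real (2 * r + 1) / 5) ^ (2 * Suc r)" .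
  qed
  moreover have "\<bar>1 / (5 * B) * f x\<bar> = 1 / (5 * B) * \<bar>f x\<bar>" for x
    using \<open>B \<ge> 0\<close> by (simp add: abs_mult)
  ultimately have "(\<Sum>x\<in>cube n. exp (1 / (5 * B) * \<bar>f x\<bar>)) \<le> 2 ^ n * 2"
    by (simp only: card_cube) simp
  then show ?thesis
    unfolding integral_cube_measure by (simp only: pos_divide_le_eq zero_less_power zero_less_numeral mult.commute)
qed

end
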